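(* Consider a threshold service policy $(T,\mu_l,\mu_h)$, where $T$ is a positive integer and $0<\mu_l<\mu_h$, and suppose that $\tilde R\mu_l\in\mathbb Z$ and $\tilde R\mu_l\le T$. Then every real $x>0$ with $x\in(\tilde R\mu_l-1,\tilde R\mu_l)$ determines a mixed threshold joining strategy $\underline{\hat p}(x)$ that is a recurrent-class equilibrium.
   Context: Model. Customers arrive at a single-server first-come-first-served queue according to a Poisson process with rate $\lambda>0$. Threshold service policy $(T,\mu_l,\mu_h)$: when $n\ge1$ customers are in the system, service is provided at exponential rate $\mu_n$, where $\mu_n=\mu_l$ if $n\le T$ and $\mu_n=\mu_h$ if $n>T$. Each arriving customer observes the number of customers present and either joins or balks. A joining customer receives a reward $R\ge0$ at service completion and pays $C>0$ per unit of time in the system, with no reneging. Let $\tilde R=R/C$. A strategy is a vector $\underline p=(p_0,p_1,\dots)\in[0,1]^\infty$, where $p_n$ is the probability that a customer who finds $n$ customers upon arrival joins. Let $n_0(\underline p)=\min\{n:p_n=0\}$. Mixed threshold strategy $\underline{\hat p}(x)$, $x>0$ not an integer: with $n_0=\lfloor x\rfloor+1$, set $p_n=1$ for $n\le n_0-2$, $p_{\lfloor x\rfloor}=x-\lfloor x\rfloor\in(0,1)$, and $p_n=0$ for $n\ge n_0$. Delay function. For $0\le n<m$, $W(n,m;\underline p)$ is the expected remaining sojourn time of a tagged customer in the system who has $n$ customers in front of her when there are $m$ customers in total (including her), when all future arrivals follow $\underline p$. That is, it is the expected time until departure of the continuous-time Markov chain started at $(n,m)$ with transitions $(i,k)\to(i,k+1)$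 at rate $\lambda p_k$, $(i,k)\to(i-1,k-1)$ at rate $\mu_k$ if $i\ge1$, and $(0,k)\to$ departure at rate $\mu_k$. $W(n;\underline p)=W(n,n+1;\underline p)$ is the expected sojourn time of a customer who finds $n$ customers upon arrival and joins. Recurrent-class equilibria. A strategy $\underline p$ with $n_0(\underline p)<\infty$ is a recurrent-class equilibrium if, for every $n\le n_0(\underline p)$: $\tilde R-W(n;\underline p)\le0$ if $p_n=0$; $\tilde R-W(n;\underline p)\ge0$ if $p_n=1$; and $\tilde R-W(n;\underline p)=0$ if $p_n\in(0,1)$. *)

theory Defs
  imports "HOL-Probability.Probability"
begin

(* Continuous-time Markov chains with transition rates Q s s' (for s' ~= s), given by their
   jump chain and holding times. Step n of the chain consumes one independent sample (e, f):
   e is a unit exponential variable, and f draws, independently for every state s, a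
   successor f s from the jump distribution of s. The chain in state s waits for e / exit_rate Q s,
   which is exponential with parameter exit_rate Q s, and then moves to f s. *)

definition exit_rate :: "('s \<Rightarrow> 's \<Rightarrow> real) \<Rightarrow> 's \<Rightarrow> real" where
  "exit_rate Q s = (\<Sum>\<^sub>\<infinity>s'. Q s s')"

definition jump_pmf :: "('s \<Rightarrow> 's \<Rightarrow> real) \<Rightarrow> 's \<Rightarrow> 's pmf" where
  "jump_pmf Q s =
    (if exit_rate Q s = 0 then return_pmf s else embed_pmf (\<lambda>s'. Q s s' / exit_rate Q s))"

definition step_measure :: "('s \<Rightarrow> 's \<Rightarrow> real) \<Rightarrow> (real \<times> ('s \<Rightarrow> 's)) measure" where
  "step_measure Q =
    density lborel (exponential_density 1) \<Otimes>\<^sub>M (\<Pi>\<^sub>M s\<in>UNIV. measure_pmf (jump_pmf Q s))"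

primrec jump_chain :: "'s \<Rightarrow> (real \<times> ('s \<Rightarrow> 's)) stream \<Rightarrow> nat \<Rightarrow> 's" where
  "jump_chain s \<omega> 0 = s"
| "jump_chain s \<omega> (Suc n) = snd (\<omega> !! n) (jump_chain s \<omega> n)"

(* The division is in ennreal, so an absorbing state is held for an infinite time. *)
definition holding_time ::
  "('s \<Rightarrow> 's \<Rightarrow> real) \<Rightarrow> 's \<Rightarrow> (real \<times> ('s \<Rightarrow> 's)) stream \<Rightarrow> nat \<Rightarrow> ennreal" where
  "holding_time Q s \<omega> n = ennreal (fst (\<omega> !! n)) / ennreal (exit_rate Q (jump_chain s \<omega> n))"

definition jump_time ::
  "('s \<Rightarrow> 's \<Rightarrow> real) \<Rightarrow> 's \<Rightarrow> (real \<times> ('s \<Rightarrow> 's)) stream \<Rightarrow> nat \<Rightarrow> ennreal" where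
  "jump_time Q s \<omega> n = (\<Sum>k<n. holding_time Q s \<omega> k)"

(* Infinite if the target is never reached (infimum of the empty set). *)
definition hitting_time ::
  "('s \<Rightarrow> 's \<Rightarrow> real) \<Rightarrow> 's set \<Rightarrow> 's \<Rightarrow> (real \<times> ('s \<Rightarrow> 's)) stream \<Rightarrow> ennreal" where
  "hitting_time Q A s \<omega> = (INF n\<in>{n. jump_chain s \<omega> n \<in> A}. jump_time Q s \<omega> n)"

definition expected_hitting_time :: "('s \<Rightarrow> 's \<Rightarrow> real) \<Rightarrow> 's set \<Rightarrow> 's \<Rightarrow> ennreal" where
  "expected_hitting_time Q A s = (\<integral>\<^sup>+\<omega>. hitting_time Q A s \<omega> \<partial>stream_space (step_measure Q))"


(* In_System i k: the tagged customer has i customers in front of her and there are k customers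
   in total, including her; only i < k is meaningful. *)
datatype tagged_state = In_System nat nat | Departed

instance tagged_state :: countable
  by countable_datatype

fun tagged_rate ::
  "real \<Rightarrow> (nat \<Rightarrow> real) \<Rightarrow> (nat \<Rightarrow> real) \<Rightarrow> tagged_state \<Rightarrow> tagged_state \<Rightarrow> real" where
  "tagged_rate lam mu p (In_System i k) s =
    (if s = In_System i (k + 1) then lam * p k
     else if i \<ge> 1 \<and> s = In_System (i - 1) (k - 1) then mu k
     else if i = 0 \<and> s = Departed then mu k
     else 0)"
| "tagged_rate lam mu p Departed s = 0"

definition threshold_service :: "nat \<Rightarrow> real \<Rightarrow> real \<Rightarrow> nat \<Rightarrow> real" where
  "threshold_service T mul muh n = (if n \<le> T then mul else muh)"

definition W_delay ::
  "real \<Rightarrow> (nat \<Rightarrow> real) \<Rightarrow> nat \<Rightarrow> nat \<Rightarrow> (nat \<Rightarrow> real) \<Rightarrow> ereal" where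
  "W_delay lam mu n m p =
    enn2ereal (expected_hitting_time (tagged_rate lam mu p) {Departed} (In_System n m))"

definition W_sojourn :: "real \<Rightarrow> (nat \<Rightarrow> real) \<Rightarrow> nat \<Rightarrow> (nat \<Rightarrow> real) \<Rightarrow> ereal" where
  "W_sojourn lam mu n p = W_delay lam mu n (n + 1) p"

definition joining_strategy :: "(nat \<Rightarrow> real) \<Rightarrow> bool" where
  "joining_strategy p \<longleftrightarrow> (\<forall>n. 0 \<le> p n \<and> p n \<le> 1)"

definition recurrent_class_equilibrium ::
  "real \<Rightarrow> (nat \<Rightarrow> real) \<Rightarrow> real \<Rightarrow> (nat \<Rightarrow> real) \<Rightarrow> bool" where
  "recurrent_class_equilibrium lam mu Rt p \<longleftrightarrow>
    joining_strategy p \<and> (\<exists>n. p n = 0) \<and>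
    (\<forall>n \<le> (LEAST n. p n = 0).
      (p n = 0 \<longrightarrow> ereal Rt - W_sojourn lam mu n p \<le> 0) \<and>
      (p n = 1 \<longrightarrow> ereal Rt - W_sojourn lam mu n p \<ge> 0) \<and>
      (0 < p n \<and> p n < 1 \<longrightarrow> ereal Rt - W_sojourn lam mu n p = 0))"

(* Integer arithmetic, since n0 - 2 is negative for x < 1. *)
definition mixed_threshold_strategy :: "real \<Rightarrow> nat \<Rightarrow> real" where
  "mixed_threshold_strategy x n =
    (let n0 = \<lfloor>x\<rfloor> + 1 in
     if int n \<le> n0 - 2 then 1
     else if int n = \<lfloor>x\<rfloor> then x - \<lfloor>x\<rfloor>
     else 0)"

end

theory Submission
  imports Defs
begin

text \<open>At the integer \<open>N = R mul / C \<le> T\<close> the number in the system never exceeds \<open>N\<close> once a customer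
  has found at most \<open>N - 1\<close> others, so she is always served at rate \<open>mul\<close> and, whatever the joining
  probability at \<open>N - 1\<close>, her expected sojourn time is \<open>(n + 1) / mul\<close>: this is exactly \<open>R / C\<close> at
  \<open>n = N - 1\<close>. A customer finding \<open>N\<close> waits at least until she is in state \<open>(N - 1, N)\<close>, whose
  expected remaining sojourn time is already \<open>R / C\<close>. Every transition of the tagged chain before
  departure decreases \<open>2 i + (N - k)\<close>, so first-step equations determine the delay by induction.\<close>

section \<open>Measurability of the jump chain and of hitting times\<close>

lemma prob_space_step_measure: "prob_space (step_measure Q)"
proof -
  interpret A: prob_space "density lborel (exponential_density 1)"
    by (rule prob_space_exponential_density) simp
  interpret B: prob_space "\<Pi>\<^sub>M s\<in>UNIV. measure_pmf (jump_pmf Q s)"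
    by (intro prob_space_PiM measure_pmf.prob_space_axioms)
  interpret P: pair_prob_space "density lborel (exponential_density 1)"
    "\<Pi>\<^sub>M s\<in>UNIV. measure_pmf (jump_pmf Q s)" ..
  show ?thesis
    unfolding step_measure_def by (rule P.prob_space_axioms)
qed

lemma measurable_fst_step_measure [measurable]: "fst \<in> borel_measurable (step_measure Q)"
  unfolding step_measure_def by measurable

lemma measurable_snd_step_measure [measurable]:
  "(\<lambda>y. snd y s) \<in> step_measure Q \<rightarrow>\<^sub>M count_space UNIV"
proof -
  have "(\<lambda>y. snd y s) \<in> step_measure Q \<rightarrow>\<^sub>M measure_pmf (jump_pmf Q s)"
    unfolding step_measure_def by measurable
  then show ?thesis
    by simp
qed

text \<open>The successor map is evaluated at a random state. Countability of the state type allows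
  splitting over the value of that state, so only fixed coordinates have to be measurable.\<close>

lemma measurable_jump_chain [measurable]:
  fixes Q :: "'s :: countable \<Rightarrow> 's \<Rightarrow> real"
  shows "(\<lambda>\<omega>. jump_chain s \<omega> n) \<in> stream_space (step_measure Q) \<rightarrow>\<^sub>M count_space UNIV"
proof (induction n)
  case (Suc n)
  note [measurable] = Suc
  have "(\<lambda>\<omega>. snd (\<omega> !! n) t) \<in> stream_space (step_measure Q) \<rightarrow>\<^sub>M count_space UNIV" for t
    by measurable
  then show ?case
    by (auto intro: measurable_compose_countable[OF _ Suc])
qed simp

text \<open>In \<open>hitting_time_def\<close> the index set depends on the sample. Assigning
  \<open>\<top>\<close> to the other indices gives an infimum over all naturals, which is measurable
  termwise and easy to shift.\<close>

lemma hitting_time_eq_INF: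
  "hitting_time Q A s \<omega> = (INF n. if jump_chain s \<omega> n \<in> A then jump_time Q s \<omega> n else \<top>)"
proof (rule antisym)
  show "hitting_time Q A s \<omega> \<le> (INF n. if jump_chain s \<omega> n \<in> A then jump_time Q s \<omega> n else \<top>)"
    unfolding hitting_time_def by (rule INF_greatest) (auto intro: INF_lower)
  show "(INF n. if jump_chain s \<omega> n \<in> A then jump_time Q s \<omega> n else \<top>) \<le> hitting_time Q A s \<omega>"
    unfolding hitting_time_def by (rule INF_greatest, rule INF_lower2) auto
qed

lemma measurable_hitting_time [measurable]:
  fixes Q :: "'s :: countable \<Rightarrow> 's \<Rightarrow> real"
  shows "hitting_time Q A s \<in> borel_measurable (stream_space (step_measure Q))"
proof -
  have [measurable]:
    "(\<lambda>\<omega>. ennreal (exit_rate Q (jump_chain s \<omega> n))) \<in> borel_measurable (stream_space (step_measure Q))"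
    for n
    by (rule measurable_compose[OF measurable_jump_chain]) simp
  have [measurable]: "(\<lambda>\<omega>. jump_time Q s \<omega> n) \<in> borel_measurable (stream_space (step_measure Q))" for n
    unfolding jump_time_def holding_time_def by measurable
  have [measurable]: "Measurable.pred (stream_space (step_measure Q)) (\<lambda>\<omega>. jump_chain s \<omega> n \<in> A)" for n
    by (rule measurable_compose[OF measurable_jump_chain]) simp
  show ?thesis
    unfolding hitting_time_eq_INF[abs_def] by measurable
qed

section \<open>First-step analysis for a general chain\<close>

lemma jump_chain_SCons: "jump_chain s (y ## \<omega>) (Suc n) = jump_chain (snd y s) \<omega> n"
  by (induction n) auto

lemma jump_time_SCons:
  "jump_time Q s (y ## \<omega>) (Suc n) =
    ennreal (fst y) / ennreal (exit_rate Q s) + jump_time Q (snd y s) \<omega> n"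
  unfolding jump_time_def sum.lessThan_Suc_shift holding_time_def
  by (simp add: jump_chain_SCons del: jump_chain.simps(2))

lemma hitting_time_SCons:
  assumes "s \<notin> A"
  shows "hitting_time Q A s (y ## \<omega>) =
    ennreal (fst y) / ennreal (exit_rate Q s) + hitting_time Q A (snd y s) \<omega>"
proof -
  let ?a = "ennreal (fst y) / ennreal (exit_rate Q s)"
  let ?g = "\<lambda>n. if jump_chain s (y ## \<omega>) n \<in> A then jump_time Q s (y ## \<omega>) n else \<top>"
  let ?h = "\<lambda>n. if jump_chain (snd y s) \<omega> n \<in> A then jump_time Q (snd y s) \<omega> n else \<top>"
  \<comment> \<open>The start lies outside \<open>A\<close>, so index 0 is neutral in the infimum
    and can be split off.\<close>
  have 0: "?g 0 = \<top>"
    using assms by simp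
  have Suc: "?g (Suc n) = ?a + ?h n" for n
    by (simp add: jump_chain_SCons jump_time_SCons del: jump_chain.simps(2))
  have "hitting_time Q A s (y ## \<omega>) = (INF n\<in>insert 0 (range Suc). ?g n)"
    unfolding hitting_time_eq_INF by (simp flip: UNIV_nat_eq)
  also have "\<dots> = (INF n. ?g (Suc n))"
    by (simp only: INF_insert 0 image_image inf_top_left)
  also have "\<dots> = ?a + (INF n. ?h n)"
    unfolding Suc by (rule INF_ennreal_const_add)
  finally show ?thesis
    unfolding hitting_time_eq_INF .
qed

lemma expected_hitting_time_target:
  assumes "s \<in> A"
  shows "expected_hitting_time Q A s = 0"
proof -
  have "hitting_time Q A s \<omega> \<le> jump_time Q s \<omega> 0" for \<omega>
    unfolding hitting_time_def using assms by (intro INF_lower) auto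
  then have "hitting_time Q A s = (\<lambda>_. 0)"
    by (auto simp: jump_time_def)
  then show ?thesis
    unfolding expected_hitting_time_def by simp
qed

lemma exit_rate_eq_sum:
  assumes "finite F" and "\<And>t. t \<notin> F \<Longrightarrow> Q s t = 0"
  shows "exit_rate Q s = (\<Sum>t\<in>F. Q s t)"
proof -
  have "exit_rate Q s = (\<Sum>\<^sub>\<infinity>t\<in>F. Q s t)"
    unfolding exit_rate_def using assms(2) by (intro infsum_cong_neutral) auto
  then show ?thesis
    using assms(1) by simp
qed

text \<open>\<open>embed_pmf\<close> has the intended weights only if they are nonnegative with
  total mass 1; the finite support \<open>F\<close> reduces both this check and the integral to
  finite sums.\<close>

lemma nn_integral_jump_pmf:
  assumes "finite F" and Q0: "\<And>t. t \<notin> F \<Longrightarrow> Q s t = 0" and nn: "\<And>t. 0 \<le> Q s t"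
    and pos: "0 < exit_rate Q s"
  shows "(\<integral>\<^sup>+t. h t \<partial>measure_pmf (jump_pmf Q s)) = (\<Sum>t\<in>F. ennreal (Q s t / exit_rate Q s) * h t)"
proof -
  have sum1: "(\<Sum>t\<in>F. Q s t / exit_rate Q s) = 1"
    using exit_rate_eq_sum[of F Q s, OF assms(1) Q0] pos by (simp flip: sum_divide_distrib)
  have "(\<integral>\<^sup>+t. ennreal (Q s t / exit_rate Q s) \<partial>count_space UNIV) =
      (\<Sum>t\<in>F. ennreal (Q s t / exit_rate Q s))"
    using assms(1) Q0 by (intro nn_integral_count_space') auto
  also have "\<dots> = 1"
    using nn pos sum1 by (subst sum_ennreal) auto
  finally have pmf: "pmf (jump_pmf Q s) t = Q s t / exit_rate Q s" for t
    unfolding jump_pmf_def using nn pos by (auto simp: pmf_embed_pmf)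
  have "(\<integral>\<^sup>+t. h t \<partial>measure_pmf (jump_pmf Q s)) =
      (\<integral>\<^sup>+t. ennreal (Q s t / exit_rate Q s) * h t \<partial>count_space UNIV)"
    by (simp add: nn_integral_measure_pmf pmf)
  also have "\<dots> = (\<Sum>t\<in>F. ennreal (Q s t / exit_rate Q s) * h t)"
    using assms(1) Q0 by (intro nn_integral_count_space') auto
  finally show ?thesis .
qed

lemma nn_integral_unit_exponential:
  "(\<integral>\<^sup>+e. ennreal e \<partial>density lborel (exponential_density 1)) = 1"
proof -
  have "(\<integral>\<^sup>+e. ennreal e \<partial>density lborel (exponential_density 1)) =
      (\<integral>\<^sup>+e. ennreal (exponential_density 1 e) * ennreal e \<partial>lborel)"
    by (subst nn_integral_density) auto
  also have "\<dots> = (\<integral>\<^sup>+e. ennreal (exponential_density 1 e * e ^ 1) \<partial>lborel)"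
    by (intro nn_integral_cong) (auto simp: ennreal_mult' exponential_density_nonneg)
  also have "\<dots> = 1"
    using nn_integral_erlang_ith_moment[of 1 0 1] by simp
  finally show ?thesis .
qed

text \<open>Condition on the first sample: the rest of the stream is independent of it with the same
  law, so it restarts the chain from the successor. Working in \<open>ennreal\<close> avoids any
  prior finiteness claim.\<close>

lemma expected_hitting_time_first_step:
  fixes Q :: "'s :: countable \<Rightarrow> 's \<Rightarrow> real"
  assumes "s \<notin> A" and "finite F" and "\<And>t. t \<notin> F \<Longrightarrow> Q s t = 0" and "\<And>t. 0 \<le> Q s t"
    and pos: "0 < exit_rate Q s"
  shows "expected_hitting_time Q A s = ennreal (1 / exit_rate Q s) +
    (\<Sum>t\<in>F. ennreal (Q s t / exit_rate Q s) * expected_hitting_time Q A t)"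
proof -
  let ?q = "exit_rate Q s" and ?E = "expected_hitting_time Q A"
  let ?D = "density lborel (exponential_density 1)"
  let ?P = "\<Pi>\<^sub>M s\<in>UNIV. measure_pmf (jump_pmf Q s)"
  interpret M: prob_space "step_measure Q"
    by (rule prob_space_step_measure)
  interpret S: prob_space "stream_space (step_measure Q)"
    by (rule M.prob_space_stream_space)
  interpret D: prob_space ?D
    by (rule prob_space_exponential_density) simp
  interpret P: prob_space ?P
    by (intro prob_space_PiM measure_pmf.prob_space_axioms)
  interpret PP: product_prob_space "\<lambda>s. measure_pmf (jump_pmf Q s)" UNIV ..
  have comp: "(\<lambda>f. f s) \<in> ?P \<rightarrow>\<^sub>M measure_pmf (jump_pmf Q s)"
    by measurable
  then have [measurable]: "(\<lambda>f. f s) \<in> ?P \<rightarrow>\<^sub>M count_space UNIV"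
    by simp
  have [measurable]: "?E \<in> borel_measurable (count_space UNIV)"
    by simp
  have "?E s = (\<integral>\<^sup>+y. (\<integral>\<^sup>+\<omega>. hitting_time Q A s (y ## \<omega>) \<partial>stream_space (step_measure Q)) \<partial>step_measure Q)"
    unfolding expected_hitting_time_def by (rule M.nn_integral_stream_space) measurable
  also have "\<dots> = (\<integral>\<^sup>+y. ennreal (fst y) / ennreal ?q + ?E (snd y s) \<partial>step_measure Q)"
    unfolding expected_hitting_time_def using assms(1)
    by (simp add: hitting_time_SCons nn_integral_add S.emeasure_space_1)
  also have "\<dots> = (\<integral>\<^sup>+e. \<integral>\<^sup>+f. ennreal e / ennreal ?q + ?E (f s) \<partial>?P \<partial>?D)"
    unfolding step_measure_def by (subst P.nn_integral_fst[symmetric]) auto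
  also have "\<dots> = (\<integral>\<^sup>+e. ennreal e / ennreal ?q + (\<integral>\<^sup>+f. ?E (f s) \<partial>?P) \<partial>?D)"
    by (simp add: nn_integral_add P.emeasure_space_1)
  also have "\<dots> = (\<integral>\<^sup>+e. ennreal e / ennreal ?q \<partial>?D) + (\<integral>\<^sup>+f. ?E (f s) \<partial>?P)"
    using D.emeasure_space_1 by (subst nn_integral_add) auto
  also have "(\<integral>\<^sup>+e. ennreal e / ennreal ?q \<partial>?D) = ennreal (1 / ?q)"
    using pos by (subst nn_integral_divide)
      (auto simp: nn_integral_unit_exponential divide_ennreal simp flip: ennreal_1)
  \<comment> \<open>Only coordinate \<open>s\<close> of the successor map is read, and its marginal
    is the jump distribution of \<open>s\<close>.\<close>
  also have "(\<integral>\<^sup>+f. ?E (f s) \<partial>?P) = (\<integral>\<^sup>+t. ?E t \<partial>distr ?P (measure_pmf (jump_pmf Q s)) (\<lambda>f. f s))"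
    by (subst nn_integral_distr[OF comp]) auto
  also have "\<dots> = (\<integral>\<^sup>+t. ?E t \<partial>measure_pmf (jump_pmf Q s))"
    by (subst PP.PiM_component) auto
  also have "\<dots> = (\<Sum>t\<in>F. ennreal (Q s t / ?q) * ?E t)"
    using assms by (intro nn_integral_jump_pmf) auto
  finally show ?thesis .
qed

section \<open>Delays of the tagged customer\<close>

definition served_state :: "nat \<Rightarrow> nat \<Rightarrow> tagged_state" where
  "served_state i k = (if i = 0 then Departed else In_System (i - 1) (k - 1))"

text \<open>\<open>served_state\<close> merges the two service branches of
  \<open>tagged_rate\<close>, so one equation with two distinct successors covers both
  \<open>i = 0\<close> and \<open>i \<ge> 1\<close>.\<close>

lemma expected_tagged_first_step:
  assumes "0 \<le> lam" and "0 \<le> p k" and "0 < mu k"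
  defines "E \<equiv> expected_hitting_time (tagged_rate lam mu p) {Departed}"
    and "q \<equiv> lam * p k + mu k"
  shows "E (In_System i k) = ennreal (1 / q) + ennreal (lam * p k / q) * E (In_System i (k + 1))
    + ennreal (mu k / q) * E (served_state i k)"
proof -
  let ?Q = "tagged_rate lam mu p" and ?s = "In_System i k"
  let ?F = "{In_System i (k + 1), served_state i k}"
  have ne: "In_System i (k + 1) \<noteq> served_state i k"
    by (auto simp: served_state_def)
  have Q: "?Q ?s (In_System i (k + 1)) = lam * p k" "?Q ?s (served_state i k) = mu k"
    by (auto simp: served_state_def)
  have Q0: "?Q ?s t = 0" if "t \<notin> ?F" for t
    using that by (auto simp: served_state_def split: if_splits)
  have nn: "0 \<le> ?Q ?s t" for t
    using assms by auto
  have q: "exit_rate ?Q ?s = q"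
    using exit_rate_eq_sum[of ?F ?Q ?s, OF _ Q0] ne Q by (simp add: q_def)
  have "0 < q"
    using assms by (simp add: q_def add_nonneg_pos)
  then show ?thesis
    using expected_hitting_time_first_step[of ?s "{Departed}" ?F ?Q] ne Q Q0 nn
    by (simp add: q E_def add.assoc)
qed

lemma expected_tagged_constant_rate:
  assumes "0 \<le> lam" and p: "\<And>n. 0 \<le> p n" and mul: "0 < mul"
    and mu: "\<And>k. k \<le> N \<Longrightarrow> mu k = mul" and "p N = 0"
    and "i < k" and "k \<le> N"
  shows "expected_hitting_time (tagged_rate lam mu p) {Departed} (In_System i k) =
    ennreal ((real i + 1) / mul)"
  using assms(6,7)
\<comment> \<open>A service lowers \<open>i\<close> by one but raises \<open>N - k\<close> by one;
  the weight 2 makes the total still drop.\<close>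
proof (induction "2 * i + (N - k)" arbitrary: i k rule: less_induct)
  case less
  let ?E = "expected_hitting_time (tagged_rate lam mu p) {Departed}"
  let ?l = "lam * p k"
  have l: "0 \<le> ?l" and pos: "0 < ?l + mul"
    using assms(1) p[of k] mul by (simp_all add: add_nonneg_pos)
  have mk: "mu k = mul"
    using mu less.prems by simp
  have served: "?E (served_state i k) = ennreal (real i / mul)"
  proof (cases i)
    case 0
    then show ?thesis
      by (simp add: served_state_def expected_hitting_time_target)
  next
    case (Suc j)
    then have "?E (In_System j (k - 1)) = ennreal ((real j + 1) / mul)"
      using less.prems by (intro less.hyps) auto
    then show ?thesis
      using Suc by (simp add: served_state_def add.commute)
  qed
  \<comment> \<open>The equality is stated with its coefficient because for \<open>k = N\<close> the
    successor is outside the induction range; there \<open>p N = 0\<close> makes both sides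
    zero.\<close>
  have joined: "ennreal (?l / (?l + mul)) * ?E (In_System i (k + 1)) =
      ennreal (?l / (?l + mul)) * ennreal ((real i + 1) / mul)"
  proof (cases "k = N")
    case True
    then show ?thesis
      using \<open>p N = 0\<close> by simp
  next
    case False
    then have "?E (In_System i (k + 1)) = ennreal ((real i + 1) / mul)"
      using less.prems by (intro less.hyps) auto
    then show ?thesis
      by simp
  qed
  have "?E (In_System i k) = ennreal (1 / (?l + mul)) +
      ennreal (?l / (?l + mul)) * ennreal ((real i + 1) / mul) +
      ennreal (mul / (?l + mul)) * ennreal (real i / mul)"
    unfolding joined[symmetric] served[symmetric]
    using expected_tagged_first_step[of lam p k mu i] assms(1) p mul by (simp add: mk)
  also have "\<dots> = ennreal (1 / (?l + mul) + ?l / (?l + mul) * ((real i + 1) / mul) +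
      mul / (?l + mul) * (real i / mul))"
    using l pos mul by (simp add: ennreal_plus ennreal_mult del: times_divide_eq_left times_divide_eq_right)
  \<comment> \<open>Clearing denominators leaves
    \<open>mul + ?l * (i + 1) + mul * i = (?l + mul) * (i + 1)\<close>: the joining rate drops
    out.\<close>
  also have "1 / (?l + mul) + ?l / (?l + mul) * ((real i + 1) / mul) +
      mul / (?l + mul) * (real i / mul) = (real i + 1) / mul"
    using pos mul by (simp add: divide_simps) (simp add: algebra_simps)
  finally show ?case .
qed

lemma W_sojourn_constant_rate:
  assumes "0 \<le> lam" and "\<And>n. 0 \<le> p n" and "0 < mul"
    and "\<And>k. k \<le> N \<Longrightarrow> mu k = mul" and "p N = 0" and "n < N"
  shows "W_sojourn lam mu n p = ereal ((real n + 1) / mul)"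
  using expected_tagged_constant_rate[of lam p mul N mu n "n + 1"] assms
  by (simp add: W_sojourn_def W_delay_def)

text \<open>Since \<open>p (N + 1) = 0\<close>, the only move from \<open>(N, N + 1)\<close> is a
  service leading to \<open>(N - 1, N)\<close>. Dropping the mean holding time leaves the
  bound.\<close>

lemma W_sojourn_full_ge:
  assumes "0 \<le> lam" and "\<And>n. 0 \<le> p n" and "0 < mul"
    and "\<And>k. k \<le> N \<Longrightarrow> mu k = mul" and "p N = 0"
    and "0 < N" and "p (N + 1) = 0" and "0 < mu (N + 1)"
  shows "ereal (real N / mul) \<le> W_sojourn lam mu N p"
proof -
  let ?E = "expected_hitting_time (tagged_rate lam mu p) {Departed}"
  have "?E (In_System (N - 1) N) = ennreal (real N / mul)"
    using expected_tagged_constant_rate[of lam p mul N mu "N - 1" N] assms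
    by (simp add: of_nat_diff)
  then have "ennreal (real N / mul) \<le> ?E (In_System N (N + 1))"
    using expected_tagged_first_step[of lam p "N + 1" mu N] assms
    by (simp add: served_state_def)
  then have "enn2ereal (ennreal (real N / mul)) \<le> enn2ereal (?E (In_System N (N + 1)))"
    by (simp add: less_eq_ennreal.rep_eq)
  then show ?thesis
    using assms(3) by (simp add: W_sojourn_def W_delay_def)
qed

section \<open>The equilibrium conditions\<close>

theorem mainTheorem7:
  fixes lam R C mul muh x :: real and T :: nat
  assumes "lam > 0" and "R \<ge> 0" and "C > 0"
    and "T \<ge> 1" and "0 < mul" and "mul < muh"
    and "(R / C) * mul \<in> \<int>" and "(R / C) * mul \<le> real T"
    and "x > 0" and "x \<in> {(R / C) * mul - 1 <..< (R / C) * mul}"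
  shows "x \<notin> \<int> \<and>
    recurrent_class_equilibrium lam (threshold_service T mul muh) (R / C)
      (mixed_threshold_strategy x)"
proof -
  obtain z where z: "(R / C) * mul = of_int z"
    using assms(7) by (auto elim: Ints_cases)
  have x: "of_int z - 1 < x" "x < of_int z"
    using assms(10) z by auto
  then have fl: "\<lfloor>x\<rfloor> = z - 1"
    by (intro floor_unique) auto
  define N where "N = nat z"
  have "0 < z"
    using x assms(9) by linarith
  then have N: "z = int N" "0 < N"
    by (auto simp: N_def)
  have RN: "R / C = real N / mul"
    using z N assms(5) by (simp add: field_simps)
  have NT: "N \<le> T"
    using z N assms(8) by simp
  let ?p = "mixed_threshold_strategy x" and ?mu = "threshold_service T mul muh"
  \<comment> \<open>Here \<open>n0 = z = N\<close>. Writing the cases with \<open>n + 1\<close>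
    avoids truncated subtraction, which matters for \<open>N = 1\<close>.\<close>
  have p: "?p n = (if n + 1 < N then 1 else if n + 1 = N then x - (real N - 1) else 0)" for n
    unfolding mixed_threshold_strategy_def Let_def fl using N by auto
  have frac: "0 < x - (real N - 1)" "x - (real N - 1) < 1"
    using x N by auto
  have p_bounds: "0 \<le> ?p n" "?p n \<le> 1" for n
    using frac by (auto simp: p)
  have pN: "?p N = 0" "?p (N + 1) = 0"
    by (auto simp: p)
  \<comment> \<open>The fractional entry at \<open>N - 1\<close> is strictly positive, so the first
    zero is at \<open>N\<close>.\<close>
  have least: "(LEAST n. ?p n = 0) = N"
    using frac pN by (intro Least_equality) (auto simp: p not_le[symmetric] split: if_splits)
  have mu: "?mu k = mul" if "k \<le> N" for k
    using that NT by (simp add: threshold_service_def)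
  \<comment> \<open>If \<open>N = T\<close>, this state is already served at rate
    \<open>muh\<close>; both rates are positive.\<close>
  have mu_pos: "0 < ?mu (N + 1)"
    using assms(5,6) by (simp add: threshold_service_def)
  have W: "W_sojourn lam ?mu n ?p = ereal ((real n + 1) / mul)" if "n < N" for n
    using assms(1,5) p_bounds mu pN that by (intro W_sojourn_constant_rate) auto
  have WN: "ereal (R / C) \<le> W_sojourn lam ?mu N ?p"
    unfolding RN using assms(1,5) p_bounds mu pN N mu_pos by (intro W_sojourn_full_ge) auto
  have "x \<notin> \<int>"
    using x by (auto elim!: Ints_cases)
  moreover have "recurrent_class_equilibrium lam ?mu (R / C) ?p"
    unfolding recurrent_class_equilibrium_def joining_strategy_def least
  proof (intro conjI allI impI)
    fix n
    show "0 \<le> ?p n" "?p n \<le> 1"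
      by (fact p_bounds)+
  next
    show "\<exists>n. ?p n = 0"
      using pN by blast
  next
    fix n
    assume "n \<le> N" and "?p n = 0"
    then have "n = N"
      using frac by (auto simp: p split: if_splits)
    \<comment> \<open>\<open>WN\<close> is only a lower bound, so the \<open>ereal\<close> case
      split also treats an infinite delay.\<close>
    then show "ereal (R / C) - W_sojourn lam ?mu n ?p \<le> 0"
      using WN by (cases "W_sojourn lam ?mu N ?p") auto
  next
    fix n
    assume "n \<le> N" and "?p n = 1"
    then have n: "n < N" "n + 1 \<le> N"
      using frac by (auto simp: p split: if_splits)
    then have "(real n + 1) / mul \<le> real N / mul"
      using assms(5) by (intro divide_right_mono) auto
    then show "0 \<le> ereal (R / C) - W_sojourn lam ?mu n ?p"
      unfolding W[OF n(1)] RN by simp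
  next
    fix n
    assume "n \<le> N" and "0 < ?p n \<and> ?p n < 1"
    \<comment> \<open>Only \<open>n = N - 1\<close> is randomized, where the delay
      \<open>N / mul\<close> equals \<open>R / C\<close>: indifference for every admissible
      \<open>x\<close>.\<close>
    then have n: "n < N" "real n + 1 = real N"
      by (auto simp: p split: if_splits)
    then show "ereal (R / C) - W_sojourn lam ?mu n ?p = 0"
      unfolding W[OF n(1)] RN by simp
  qed
  ultimately show ?thesis
    by blast
qed

end
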